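(* Let $a\in(0,1)$ be fixed. Then, as $n\to\infty$, $$P_n^S\bigl(2;2\lfloor an/2\rfloor\bigr)=\log\left(1-\frac{3}{2\sqrt{\pi na(1-a)}}+O\bigl(n^{-3/2}\bigr)\right).$$
   Context: For integers $n,j\ge 0$ and $z>0$, let $C_n(z;j)$ be the partition function of pairs of lattice paths in $\mathbb{Z}^2$ with steps $(1,1)$ and $(1,-1)$ such that: the bottom path goes from $(0,0)$ to $(2n,0)$ and never goes below $Y=0$ (a Dyck path); the top path goes from $(0,2)$ to $(2n,2j+2)$; and the two paths have no vertex in common. Each pair is weighted by $z^{v}$, where $v$ is the number of vertices of the bottom path on $Y=0$ other than the origin. For example $C_0(z;0)=1$, $C_1(z;0)=C_1(z;1)=z$, $C_2(z;0)=z+2z^2$. The case $j=0$ describes (after removal of the two end vertices) staircase polygons grafted at both ends to the adsorbing line. For $0<q<n$, the partition function of those pairs counted by $C_n(z;0)$ whose bottom path passes through the vertex at horizontal distance $2q$ from the origin on $Y=0$ (so $q$, like $n$, is measured in half-lengths) is $$Z_n^*(z;q)=\sum_{j=0}^nC_q(z;j)\,C_{n-q}(z;j),$$ and the pressure is $$P_n^S(z;q)=\log\left(1-\frac{Z_n^*(z;q)}{C_n(z;0)}\right).$$ *)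

theory Defs
  imports "HOL-Analysis.Analysis"
begin

type_synonym vertex = "int \<times> int"

definition path_step :: "vertex \<Rightarrow> vertex \<Rightarrow> bool" where
  "path_step u v \<longleftrightarrow>
     v = (fst u + 1, snd u + 1) \<or> v = (fst u + 1, snd u - 1)"

text \<open>A path is the list of its vertices, including both end points.\<close>

definition lattice_path :: "vertex \<Rightarrow> vertex \<Rightarrow> vertex list \<Rightarrow> bool" where
  "lattice_path u v p \<longleftrightarrow>
     p \<noteq> [] \<and> hd p = u \<and> last p = v \<and> successively path_step p"

definition path_pairs :: "nat \<Rightarrow> nat \<Rightarrow> (vertex list \<times> vertex list) set" where
  "path_pairs n j = {(b, t).
     lattice_path (0, 0) (2 * int n, 0) b \<and> (\<forall>v\<in>set b. 0 \<le> snd v) \<and>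
     lattice_path (0, 2) (2 * int n, 2 * int j + 2) t \<and>
     set b \<inter> set t = {}}"

text \<open>The vertices of a path have pairwise different abscissae, so counting the elements of
  the vertex set counts each visit once.\<close>

definition visits :: "vertex list \<Rightarrow> nat" where
  "visits b = card {v \<in> set b. snd v = 0 \<and> v \<noteq> (0, 0)}"

definition C_pf :: "nat \<Rightarrow> real \<Rightarrow> nat \<Rightarrow> real" where
  "C_pf n z j = (\<Sum>(b, t)\<in>path_pairs n j. z ^ visits b)"

text \<open>\<open>Z_star\<close> and \<open>P_S\<close> are meant for \<open>0 < q < n\<close> only.  In the sum, \<open>j\<close> is the common height
  parameter of the top path above the vertex \<open>(2 q, 0)\<close> of the bottom path; the part of the pair
  to the right of that vertex is read from right to left.\<close>

definition Z_star :: "nat \<Rightarrow> real \<Rightarrow> nat \<Rightarrow> real" where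
  "Z_star n z q = (\<Sum>j=0..n. C_pf q z j * C_pf (n - q) z j)"

definition P_S :: "nat \<Rightarrow> real \<Rightarrow> nat \<Rightarrow> real" where
  "P_S n z q = ln (1 - Z_star n z q / C_pf n z 0)"

text \<open>The sum defining \<open>C_pf\<close> is finite, so it does not collapse to the default value \<open>0\<close>.\<close>

lemma finite_paths_from:
  "finite {p. length p = Suc m \<and> hd p = u \<and> successively path_step p}"
proof (induction m arbitrary: u)
  case 0
  have "{p. length p = Suc 0 \<and> hd p = u \<and> successively path_step p} \<subseteq> {[u]}"
    by (auto simp: length_Suc_conv)
  then show ?case using finite_subset by blast
next
  case (Suc m)
  let ?S = "\<lambda>u. {p. length p = Suc m \<and> hd p = u \<and> successively path_step p}"
  have "{p. length p = Suc (Suc m) \<and> hd p = u \<and> successively path_step p}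
    \<subseteq> (#) u ` (?S (fst u + 1, snd u + 1) \<union> ?S (fst u + 1, snd u - 1))"
  proof
    fix p assume p: "p \<in> {p. length p = Suc (Suc m) \<and> hd p = u \<and> successively path_step p}"
    then obtain v r where pr: "p = u # v # r"
      by (auto simp: length_Suc_conv)
    with p have "v # r \<in> ?S v" "path_step u v" by auto
    then show "p \<in> (#) u ` (?S (fst u + 1, snd u + 1) \<union> ?S (fst u + 1, snd u - 1))"
      unfolding pr path_step_def by auto
  qed
  then show ?case using Suc.IH by (meson finite_UnI finite_imageI finite_subset)
qed

lemma fst_last_path:
  "p \<noteq> [] \<Longrightarrow> successively path_step p \<Longrightarrow> fst (last p) = fst (hd p) + int (length p) - 1"
  by (induction p rule: induct_list012) (auto simp: path_step_def)

lemma finite_lattice_paths: "finite {p. lattice_path u v p}"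
proof -
  have "{p. lattice_path u v p}
    \<subseteq> {p. length p = Suc (nat (fst v - fst u)) \<and> hd p = u \<and> successively path_step p}"
  proof
    fix p assume "p \<in> {p. lattice_path u v p}"
    then have p: "p \<noteq> []" "hd p = u" "last p = v" "successively path_step p"
      by (auto simp: lattice_path_def)
    with fst_last_path[of p] have "fst v = fst u + int (length p) - 1" by simp
    moreover have "length p > 0" using p by simp
    ultimately have "length p = Suc (nat (fst v - fst u))" by linarith
    with p show "p \<in> {p. length p = Suc (nat (fst v - fst u)) \<and> hd p = u
        \<and> successively path_step p}" by simp
  qed
  then show ?thesis using finite_paths_from finite_subset by blast
qed

lemma finite_path_pairs: "finite (path_pairs n j)"
proof (rule finite_subset)
  show "path_pairs n j \<subseteq> {p. lattice_path (0, 0) (2 * int n, 0) p}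
      \<times> {p. lattice_path (0, 2) (2 * int n, 2 * int j + 2) p}"
    by (auto simp: path_pairs_def)
qed (simp add: finite_lattice_paths)

end

theory Submission
  imports Defs "HOL-Real_Asymp.Real_Asymp"
begin

text \<open>The pairs are counted by a Lindstroem--Gessel--Viennot determinant of one-path weights.
  For \<open>z = 2\<close>, reflecting excursions turns these weights into numbers of free walks. With
  \<open>b\<^sub>m\<close> the central binomial coefficient and \<open>w\<^sub>m(i)\<close> the number of free walks with \<open>2m\<close> steps
  ending at \<open>2i\<close> this gives
  \<open>C\<^sub>m(2;j) = b\<^sub>m w\<^sub>m\<^sub>+\<^sub>1(j+1) - b\<^sub>m\<^sub>+\<^sub>1 w\<^sub>m(j+1)\<close>. The right-hand side is even in \<open>j+1\<close> and vanishes at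
  \<open>j = -1\<close>, so \<open>Z\<^sub>n\<^sup>*\<close> is half of a sum over all integers, which Vandermonde evaluates. With
  \<open>p = n - q\<close>,
  \<open>Z\<^sub>n\<^sup>*(2;q) / C\<^sub>n(2;0) = (b\<^sub>q b\<^sub>p / b\<^sub>n) (n+1)/(2n+1) (3 - (n+2)/((q+1)(p+1)))\<close>,
  and the two-sided Wallis bounds for \<open>b\<^sub>m\<close> give the asymptotics.\<close>

section \<open>Pairs of disjoint paths, grown one step at a time\<close>

lemma lattice_path_fst_le:
  assumes "lattice_path u v p" "x \<in> set p"
  shows "fst x \<le> fst v"
proof -
  have "successively path_step p \<Longrightarrow> x \<in> set p \<Longrightarrow> fst x \<le> fst (last p)"
    by (induction p rule: rev_induct)
       (fastforce simp: successively_append_iff path_step_def)+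
  with assms show ?thesis by (auto simp: lattice_path_def)
qed

lemma lattice_path_append_vertex:
  assumes "p \<noteq> []"
  shows "lattice_path u v (p @ [x]) \<longleftrightarrow>
    x = v \<and> (\<exists>v'. lattice_path u v' p \<and> path_step v' v)"
  using assms by (auto simp: lattice_path_def successively_append_iff)

lemma lattice_path_Suc:
  "lattice_path (0, s) (int (Suc m), h) p \<longleftrightarrow>
    (\<exists>p' \<in> {p'. lattice_path (0, s) (int m, h - 1) p'} \<union> {p'. lattice_path (0, s) (int m, h + 1) p'}.
      p = p' @ [(int (Suc m), h)])"
proof (cases p rule: rev_cases)
  case Nil
  then show ?thesis by (simp add: lattice_path_def)
next
  case (snoc p' x)
  show ?thesis
  proof (cases "p' = []")
    case True
    then show ?thesis using snoc by (auto simp: lattice_path_def)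
  next
    case False
    have "(\<exists>v'. lattice_path (0, s) v' p' \<and> path_step v' (int (Suc m), h)) \<longleftrightarrow>
        lattice_path (0, s) (int m, h - 1) p' \<or> lattice_path (0, s) (int m, h + 1) p'"
    proof
      assume "\<exists>v'. lattice_path (0, s) v' p' \<and> path_step v' (int (Suc m), h)"
      then obtain v' where v': "lattice_path (0, s) v' p'" "path_step v' (int (Suc m), h)"
        by blast
      then have "v' = (int m, h - 1) \<or> v' = (int m, h + 1)"
        by (cases v') (auto simp: path_step_def)
      with v' show "lattice_path (0, s) (int m, h - 1) p' \<or> lattice_path (0, s) (int m, h + 1) p'"
        by blast
    qed (force simp: path_step_def)
    then show ?thesis
      using snoc lattice_path_append_vertex[OF False, of "(0, s)" "(int (Suc m), h)" x] by auto
  qed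
qed

text \<open>Any number of steps and any end heights are allowed, so that the family is closed under
  deleting the last vertex of both paths.\<close>

definition pairs :: "nat \<Rightarrow> int \<Rightarrow> int \<Rightarrow> (vertex list \<times> vertex list) set" where
  "pairs m h k = {(b, t).
     lattice_path (0, 0) (int m, h) b \<and> (\<forall>v\<in>set b. 0 \<le> snd v) \<and>
     lattice_path (0, 2) (int m, k) t \<and> set b \<inter> set t = {}}"

definition pair_weight :: "real \<Rightarrow> nat \<Rightarrow> int \<Rightarrow> int \<Rightarrow> real" where
  "pair_weight z m h k = (\<Sum>(b, t)\<in>pairs m h k. z ^ visits b)"

lemma C_pf_eq_pair_weight: "C_pf n z j = pair_weight z (2 * n) 0 (2 * int j + 2)"
  by (simp add: C_pf_def pair_weight_def path_pairs_def pairs_def)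

lemma finite_pairs: "finite (pairs m h k)"
  by (rule finite_subset[where B = "{p. lattice_path (0, 0) (int m, h) p}
      \<times> {p. lattice_path (0, 2) (int m, k) p}"])
     (auto simp: pairs_def finite_lattice_paths)

lemma pairs_disjoint:
  assumes "(h, k) \<noteq> (h', k')"
  shows "pairs m h k \<inter> pairs m h' k' = {}"
  using assms by (auto simp: pairs_def lattice_path_def)

lemma pairs_empty: "h < 0 \<or> h = k \<Longrightarrow> pairs m h k = {}"
proof -
  assume *: "h < 0 \<or> h = k"
  have "False" if "(b, t) \<in> pairs m h k" for b t
  proof -
    have "(int m, h) \<in> set b" "(int m, k) \<in> set t"
      using that by (auto simp: pairs_def lattice_path_def dest: last_in_set)
    with * that show False by (auto simp: pairs_def)
  qed
  then show ?thesis by auto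
qed

text \<open>All earlier vertices have abscissa at most \<open>m\<close>, so the two new ones can
  only meet each other; \<open>h \<noteq> k\<close> excludes this, and \<open>0 \<le> h\<close>
  keeps the bottom path on or above the line.\<close>

lemma pairs_Suc:
  assumes "0 \<le> h" "h \<noteq> k"
  shows "pairs (Suc m) h k = (\<lambda>(b, t). (b @ [(int (Suc m), h)], t @ [(int (Suc m), k)])) `
    (pairs m (h - 1) (k - 1) \<union> pairs m (h - 1) (k + 1) \<union>
     pairs m (h + 1) (k - 1) \<union> pairs m (h + 1) (k + 1))" (is "_ = ?f ` ?U")
proof (intro equalityI subsetI)
  fix x assume x: "x \<in> pairs (Suc m) h k"
  obtain b t where "x = (b, t)" by (cases x)
  with x obtain b' t' where "x = ?f (b', t')" "(b', t') \<in> ?U"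
    unfolding pairs_def lattice_path_Suc by fastforce
  then show "x \<in> ?f ` ?U" by blast
next
  fix x assume "x \<in> ?f ` ?U"
  then obtain b t where x: "x = ?f (b, t)" and bt: "(b, t) \<in> ?U" by auto
  then have "\<exists>h'. lattice_path (0, 0) (int m, h') b" "\<exists>k'. lattice_path (0, 2) (int m, k') t"
    by (auto simp: pairs_def)
  then have "fst v \<le> int m" if "v \<in> set b \<union> set t" for v
    using that lattice_path_fst_le by fastforce
  then have "(int (Suc m), h) \<notin> set t" "(int (Suc m), k) \<notin> set b" by fastforce+
  with bt assms show "x \<in> pairs (Suc m) h k"
    unfolding x pairs_def lattice_path_Suc by auto
qed

lemma visits_append:
  assumes "lattice_path (0, 0) (int m, h') b"
  shows "visits (b @ [(int (Suc m), h)]) = visits b + (if h = 0 then 1 else 0)"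
proof -
  have new: "(int (Suc m), h) \<notin> set b"
    using lattice_path_fst_le[OF assms] by fastforce
  let ?V = "{v \<in> set b. snd v = 0 \<and> v \<noteq> (0, 0)}"
  have "{v \<in> set (b @ [(int (Suc m), h)]). snd v = 0 \<and> v \<noteq> (0, 0)} =
      (if h = 0 then insert (int (Suc m), h) ?V else ?V)"
    by auto
  moreover have "(int (Suc m), h) \<notin> ?V" "finite ?V"
    using new by simp_all
  then have "card (insert (int (Suc m), h) ?V) = Suc (card ?V)"
    by (intro card_insert_disjoint)
  ultimately show ?thesis unfolding visits_def by (cases "h = 0") (simp_all only: if_True if_False simp_thms Suc_eq_plus1 add_0_right)
qed

lemma pair_weight_Suc:
  assumes "0 \<le> h" "h \<noteq> k"
  shows "pair_weight z (Suc m) h k = (if h = 0 then z else 1) *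
    (pair_weight z m (h - 1) (k - 1) + pair_weight z m (h - 1) (k + 1) +
     pair_weight z m (h + 1) (k - 1) + pair_weight z m (h + 1) (k + 1))"
proof -
  let ?f = "\<lambda>(b, t). (b @ [(int (Suc m), h)], t @ [(int (Suc m), k)])"
  let ?U = "pairs m (h - 1) (k - 1) \<union> pairs m (h - 1) (k + 1) \<union>
     pairs m (h + 1) (k - 1) \<union> pairs m (h + 1) (k + 1)"
  let ?w = "\<lambda>(b, t). z ^ visits b"
  have "pair_weight z (Suc m) h k = (\<Sum>x\<in>?U. ?w (?f x))"
    unfolding pair_weight_def pairs_Suc[OF assms]
    by (subst sum.reindex) (auto simp: inj_on_def case_prod_unfold)
  also have "\<dots> = (\<Sum>x\<in>?U. (if h = 0 then z else 1) * ?w x)"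
  proof (rule sum.cong)
    fix x assume "x \<in> ?U"
    then obtain b t h' where "x = (b, t)" "lattice_path (0, 0) (int m, h') b"
      by (auto simp: pairs_def)
    then show "?w (?f x) = (if h = 0 then z else 1) * ?w x"
      using visits_append[of m h' b h] by simp
  qed simp
  also have "\<dots> = (if h = 0 then z else 1) * (\<Sum>x\<in>?U. ?w x)"
    by (simp add: sum_distrib_left)
  also have "(\<Sum>x\<in>?U. ?w x) = pair_weight z m (h - 1) (k - 1) + pair_weight z m (h - 1) (k + 1) +
     pair_weight z m (h + 1) (k - 1) + pair_weight z m (h + 1) (k + 1)"
    unfolding pair_weight_def
    by (subst sum.union_disjoint, simp_all add: finite_pairs Int_Un_distrib2 pairs_disjoint)+
  finally show ?thesis .
qed

section \<open>One-path weights and their determinant\<close>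

text \<open>The start vertex carries no \<open>z\<close>, as \<open>visits\<close> omits the origin.
  Paths from height 2 also collect \<open>z\<close> on the line, since the determinant ranges over
  intersecting pairs too.\<close>

fun path_weight :: "real \<Rightarrow> int \<Rightarrow> nat \<Rightarrow> int \<Rightarrow> real" where
  "path_weight z s 0 h = (if h = s then 1 else 0)"
| "path_weight z s (Suc m) h = (if h < 0 then 0 else
     (if h = 0 then z else 1) * (path_weight z s m (h - 1) + path_weight z s m (h + 1)))"

lemma path_weight_neg: "0 \<le> s \<Longrightarrow> h < 0 \<Longrightarrow> path_weight z s m h = 0"
  by (cases m) auto

lemma pair_weight_0:
  "pair_weight z 0 h k = (if h = 0 \<and> k = 2 then 1 else 0)"
proof -
  have *: "lattice_path (0, s) (0, h) p \<longleftrightarrow> h = s \<and> p = [(0, s)]" for s h p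
  proof
    assume p: "lattice_path (0, s) (0, h) p"
    then have "length p = 1"
      using fst_last_path[of p] by (auto simp: lattice_path_def)
    then show "h = s \<and> p = [(0, s)]"
      using p by (auto simp: lattice_path_def length_Suc_conv)
  qed (auto simp: lattice_path_def)
  have "pairs 0 h k = (if h = 0 \<and> k = 2 then {([(0, 0)], [(0, 2)])} else {})"
    by (auto simp: pairs_def *)
  moreover have "visits [(0, 0)] = 0" by (auto simp: visits_def)
  ultimately show ?thesis by (simp add: pair_weight_def)
qed

text \<open>The determinant obeys the same recursion as the pairs: it vanishes for equal end heights,
  being antisymmetric in them, and heights of equal parity cannot change order in one step
  without having been equal.\<close>

lemma pair_weight_det:
  assumes "- 1 \<le> h" "h \<le> k" "even (k - h)"
  shows "pair_weight z m h k =
    path_weight z 0 m h * path_weight z 2 m k - path_weight z 0 m k * path_weight z 2 m h"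
  using assms
proof (induction m arbitrary: h k)
  case 0
  then show ?case by (auto simp: pair_weight_0)
next
  case (Suc m)
  show ?case
  proof (cases "h < 0 \<or> h = k")
    \<comment> \<open>Height -1 occurs as a predecessor of height 0. Admitting it as
      \<open>h\<close> lets the induction hypothesis cover that step; both sides are 0
      there.\<close>
    case True
    then show ?thesis by (auto simp: pair_weight_def pairs_empty)
  next
    case False
    then have hk: "0 \<le> h" "h \<noteq> k" by auto
    have gap: "h + 1 \<le> k - 1" using False Suc.prems by presburger
    have IH: "pair_weight z m h' k' =
        path_weight z 0 m h' * path_weight z 2 m k' - path_weight z 0 m k' * path_weight z 2 m h'"
      if "h' \<in> {h - 1, h + 1}" "k' \<in> {k - 1, k + 1}" for h' k'
      using that hk gap Suc.prems by (intro Suc.IH) auto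
    \<comment> \<open>The top end height is positive, so in each product only the factor at
      \<open>h\<close> can contribute a \<open>z\<close>.\<close>
    have k: "0 < k" using hk gap by simp
    show ?thesis
      unfolding pair_weight_Suc[OF hk] using hk k by (simp add: IH) (simp add: algebra_simps)
  qed
qed

section \<open>Free walks and reflection at fugacity 2\<close>

fun walks :: "nat \<Rightarrow> int \<Rightarrow> real" where
  "walks 0 h = (if h = 0 then 1 else 0)"
| "walks (Suc m) h = walks m (h - 1) + walks m (h + 1)"

lemma walks_minus [simp]: "walks m (- h) = walks m h"
proof (induction m arbitrary: h)
  case (Suc m)
  have "- h - 1 = - (h + 1)" "- h + 1 = - (h - 1)" by simp_all
  then show ?case by (simp only: walks.simps Suc add.commute)
qed simp

lemma walks_eq_0: "int m < \<bar>h\<bar> \<Longrightarrow> walks m h = 0"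
  by (induction m arbitrary: h) auto

text \<open>Ending at \<open>2 * k - m\<close> means \<open>k\<close> upward steps out of
  \<open>m\<close>; in this indexing the recursion is Pascal's rule.\<close>

lemma walks_binomial: "walks m (2 * int k - int m) = real (m choose k)"
proof (induction m arbitrary: k)
  case 0
  then show ?case by (cases k) auto
next
  case (Suc m)
  show ?case
  proof (cases k)
    case 0
    then show ?thesis using Suc[of 0] by (simp add: walks_eq_0)
  next
    case (Suc k')
    then show ?thesis using Suc.IH[of k'] Suc.IH[of k] by (simp add: algebra_simps)
  qed
qed

text \<open>At fugacity 2 each excursion from the line may be reflected freely.\<close>

lemma path_weight_2_from_0:
  "0 \<le> h \<Longrightarrow> path_weight 2 0 m h = walks m h"
proof (induction m arbitrary: h)
  case (Suc m)
  then show ?case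
    using walks_minus[of m 1] by (cases "h = 0") (auto simp: path_weight_neg)
qed simp

text \<open>Method of images with a second source at \<open>- s\<close>: the sum is even in
  \<open>h\<close>, so on the line both neighbours contribute equally, which is the factor
  2.\<close>

lemma path_weight_2_from_pos:
  assumes "0 < s"
  shows "0 \<le> h \<Longrightarrow> path_weight 2 s m h = walks m (h - s) + walks m (h + s)"
proof (induction m arbitrary: h)
  case 0
  then show ?case using assms by auto
next
  case (Suc m)
  then show ?case
    using walks_minus[of m "1 - s"] walks_minus[of m "s + 1"] assms
    by (cases "h = 0") (auto simp: path_weight_neg algebra_simps)
qed

section \<open>Walks of even length and the closed form of \<open>C_pf n 2 j\<close>\<close>

definition even_walks :: "nat \<Rightarrow> int \<Rightarrow> real" where
  "even_walks n i = walks (2 * n) (2 * i)"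

lemma even_walks_0: "even_walks 0 i = (if i = 0 then 1 else 0)"
  by (simp add: even_walks_def)

lemma even_walks_Suc:
  "even_walks (Suc n) i = even_walks n (i - 1) + 2 * even_walks n i + even_walks n (i + 1)"
  by (simp add: even_walks_def algebra_simps)

lemma even_walks_minus: "even_walks n (- i) = even_walks n i"
  using walks_minus[of "2 * n" "2 * i"] by (simp add: even_walks_def del: walks_minus)

lemma even_walks_binomial: "even_walks n (int j) = real (2 * n choose (n + j))"
  using walks_binomial[of "2 * n" "n + j"] by (simp add: even_walks_def)

definition central :: "nat \<Rightarrow> real" where
  "central n = even_walks n 0"

lemma central_pos: "0 < central n"
  using even_walks_binomial[of n 0] by (simp add: central_def)

lemma even_walks_1: "even_walks n 1 = central n * (real n / (real n + 1))"
proof -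
  have "Suc n * (2 * n choose Suc n) = n * (2 * n choose n)"
    using choose_reduce_nat[of "Suc (2 * n)" "Suc n"] Suc_times_binomial_eq[of "2 * n" n]
    by (simp add: algebra_simps)
  then have "real (Suc n * (2 * n choose Suc n)) = real (n * (2 * n choose n))"
    by (rule arg_cong)
  then show ?thesis
    using even_walks_binomial[of n 1] even_walks_binomial[of n 0]
    by (simp add: central_def field_simps)
qed

lemma central_Suc: "central (Suc n) = central n * (2 * (2 * real n + 1) / (real n + 1))"
  using even_walks_Suc[of n 0] even_walks_minus[of n 1] even_walks_1[of n]
  by (simp add: central_def[symmetric]) (simp add: field_simps)

text \<open>With \<open>b = central n\<close> and \<open>w = even_walks n\<close> the determinant is
  \<open>b * (w j + w (j + 2)) - w (j + 1) * (2 * w 1)\<close>. Adding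
  \<open>2 * b * w (j + 1)\<close> to both products completes the three-term recursions at
  \<open>j + 1\<close> and at 0.\<close>

lemma C_pf_2:
  "C_pf n 2 j = central n * even_walks (Suc n) (int (Suc j)) -
     central (Suc n) * even_walks n (int (Suc j))"
  unfolding C_pf_eq_pair_weight central_def even_walks_Suc
  using even_walks_minus[of n 1]
  by (subst pair_weight_det)
     (auto simp: path_weight_2_from_0 path_weight_2_from_pos even_walks_def algebra_simps)

text \<open>Both values at 1 are multiples of central ones, and
  \<open>(n + 1) / (n + 2) - n / (n + 1) = 1 / ((n + 1) * (n + 2))\<close>.\<close>

lemma C_pf_2_0: "C_pf n 2 0 = central n * central (Suc n) / ((real n + 1) * (real n + 2))"
  using even_walks_1[of n] even_walks_1[of "Suc n"]
  by (simp add: C_pf_2) (simp add: divide_simps, simp add: algebra_simps)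

section \<open>Vandermonde sums and the exact ratio\<close>

text \<open>A walk of \<open>2 * (q + p)\<close> steps is cut after \<open>2 * q\<close> steps. The
  index set may be any finite superset of the support, so that the induction can shift it.\<close>

lemma even_walks_convolution:
  assumes "finite A" "{- int q..int q} \<subseteq> A"
  shows "(\<Sum>i\<in>A. even_walks q i * even_walks p (h - i)) = even_walks (q + p) h"
  using assms
proof (induction q arbitrary: A h)
  case 0
  have "(\<Sum>i\<in>A. even_walks 0 i * even_walks p (h - i)) =
      (\<Sum>i\<in>{0}. even_walks 0 i * even_walks p (h - i))"
    using 0 by (intro sum.mono_neutral_right) (auto simp: even_walks_0)
  then show ?case by (simp add: even_walks_0)
next
  case (Suc q)
  have shift: "(\<Sum>i\<in>A. even_walks q (i + d) * even_walks p (h - i)) =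
      even_walks (q + p) (h + d)" if "\<bar>d\<bar> \<le> 1" for d
  proof -
    \<comment> \<open>\<open>A\<close> contains the support for \<open>Suc q\<close>, which is
      larger by one on each side, so after a shift by at most 1 it still covers the support for
      \<open>q\<close>.\<close>
    have "{- int q..int q} \<subseteq> (\<lambda>i. i + d) ` A"
    proof
      fix i assume "i \<in> {- int q..int q}"
      with that Suc.prems(2) have "i - d \<in> A" by force
      then show "i \<in> (\<lambda>i. i + d) ` A" by force
    qed
    with Suc.prems(1) have "(\<Sum>i\<in>(\<lambda>i. i + d) ` A. even_walks q i * even_walks p (h + d - i)) =
        even_walks (q + p) (h + d)"
      by (intro Suc.IH) auto
    then show ?thesis by (subst (asm) sum.reindex) (auto simp: inj_on_def)
  qed
  have "(\<Sum>i\<in>A. even_walks (Suc q) i * even_walks p (h - i)) =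
      (\<Sum>i\<in>A. even_walks q (i + - 1) * even_walks p (h - i)) +
      2 * (\<Sum>i\<in>A. even_walks q (i + 0) * even_walks p (h - i)) +
      (\<Sum>i\<in>A. even_walks q (i + 1) * even_walks p (h - i))"
    unfolding even_walks_Suc sum_distrib_left sum.distrib[symmetric]
    by (intro sum.cong refl) (simp add: algebra_simps)
  also have "\<dots> = even_walks (Suc q + p) h"
    by (subst shift, simp)+ (simp add: even_walks_Suc)
  finally show ?case .
qed

lemma even_walks_inner_product:
  assumes "finite A" "{- int q..int q} \<subseteq> A"
  shows "(\<Sum>i\<in>A. even_walks q i * even_walks p i) = central (q + p)"
  using even_walks_convolution[OF assms, of p 0] by (simp add: even_walks_minus central_def)

lemma Z_star_2:
  assumes "n = q + p"
  shows "2 * Z_star n 2 q = central q * central p * central (n + 2)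
    - (central q * central (Suc p) + central (Suc q) * central p) * central (n + 1)
    + central (Suc q) * central (Suc p) * central n"
proof -
  define g where "g m i = central m * even_walks (Suc m) i - central (Suc m) * even_walks m i"
    for m i
  have g_minus: "g m (- i) = g m i" for m i
    by (simp add: g_def even_walks_minus)
  have g_0: "g m 0 = 0" for m
    by (simp add: g_def central_def)
  \<comment> \<open>The index \<open>i = j + 1\<close> runs up to \<open>n + 1\<close>; this range
    also covers the supports of \<open>even_walks q\<close> and \<open>even_walks (Suc q)\<close>,
    as the inner products require.\<close>
  let ?N = "int n + 1"
  have pos: "Z_star n 2 q = (\<Sum>i=1..?N. g q i * g p i)"
    unfolding Z_star_def
    by (rule sum.reindex_bij_witness[where i = "\<lambda>i. nat (i - 1)" and j = "\<lambda>j. int (Suc j)"])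
       (auto simp: C_pf_2 g_def assms)
  also have "\<dots> = (\<Sum>i=-?N..-1. g q i * g p i)"
    by (rule sum.reindex_bij_witness[where i = uminus and j = uminus]) (auto simp: g_minus)
  finally have neg: "Z_star n 2 q = (\<Sum>i=-?N..-1. g q i * g p i)" .
  have "{-?N..?N} = {-?N..-1} \<union> ({0} \<union> {1..?N})" by auto
  then have "(\<Sum>i=-?N..?N. g q i * g p i) =
      (\<Sum>i=-?N..-1. g q i * g p i) + (\<Sum>i=1..?N. g q i * g p i)"
    by (simp only:, subst sum.union_disjoint) (auto simp: g_0)
  then have "2 * Z_star n 2 q = (\<Sum>i=-?N..?N. g q i * g p i)"
    unfolding pos[symmetric] neg[symmetric] by simp
  also have "\<dots> =
      central q * central p * (\<Sum>i=-?N..?N. even_walks (Suc q) i * even_walks (Suc p) i)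
      - central q * central (Suc p) * (\<Sum>i=-?N..?N. even_walks (Suc q) i * even_walks p i)
      - central (Suc q) * central p * (\<Sum>i=-?N..?N. even_walks q i * even_walks (Suc p) i)
      + central (Suc q) * central (Suc p) * (\<Sum>i=-?N..?N. even_walks q i * even_walks p i)"
    unfolding sum_distrib_left sum_subtractf[symmetric] sum.distrib[symmetric]
    by (intro sum.cong refl) (simp add: g_def algebra_simps)
  also have "\<dots> = central q * central p * central (Suc q + Suc p)
      - central q * central (Suc p) * central (Suc q + p)
      - central (Suc q) * central p * central (q + Suc p)
      + central (Suc q) * central (Suc p) * central (q + p)"
    using assms by (subst (1 2 3 4) even_walks_inner_product) auto
  finally show ?thesis using assms by (simp add: algebra_simps)
qed

lemma Z_star_ratio:
  assumes "n = q + p"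
  shows "Z_star n 2 q / C_pf n 2 0 = central q * central p / central n *
    ((real n + 1) / (2 * real n + 1) * (3 - (real n + 2) / ((real q + 1) * (real p + 1))))"
proof -
  \<comment> \<open>The ratio of consecutive central binomial coefficients; it reduces everything to
    \<open>central q\<close>, \<open>central p\<close>, \<open>central n\<close> and a rational
    function.\<close>
  define r where "r m = 2 * (2 * real m + 1) / (real m + 1)" for m
  have r_pos: "0 < r m" for m by (simp add: r_def)
  have c: "central (Suc m) = central m * r m" for m
    by (simp add: central_Suc r_def)
  have "Z_star n 2 q = central q * central p * central n *
      (r n * r (Suc n) - (r p + r q) * r n + r q * r p) / 2"
    using Z_star_2[OF assms] by (simp add: c algebra_simps)
  moreover have "C_pf n 2 0 = central n * central n * r n / ((real n + 1) * (real n + 2))"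
    by (simp add: C_pf_2_0 c)
  ultimately have "Z_star n 2 q / C_pf n 2 0 = central q * central p / central n *
      ((r n * r (Suc n) - (r p + r q) * r n + r q * r p) * (real n + 1) * (real n + 2) / (2 * r n))"
    using central_pos[of n] r_pos[of n] by (simp only:) (simp add: divide_simps)
  also have "(r n * r (Suc n) - (r p + r q) * r n + r q * r p) * (real n + 1) * (real n + 2) / (2 * r n)
      = (real n + 1) / (2 * real n + 1) * (3 - (real n + 2) / ((real q + 1) * (real p + 1)))"
  proof -
    \<comment> \<open>The denominators of \<open>r q\<close>, \<open>r p\<close>, \<open>r n\<close>
      and \<open>r (Suc n)\<close> become \<open>x\<close>, \<open>y\<close>,
      \<open>x + y - 1\<close> and \<open>x + y\<close>, and clearing them leaves a polynomial
      identity.\<close>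
    define x y where "x = real q + 1" and "y = real p + 1"
    have xy: "x > 0" "y > 0" "x + y > 1" "2 * (x + y) > 3" "real q = x - 1" "real p = y - 1"
      "real n = x + y - 2"
      by (auto simp: x_def y_def assms)
    have "(r n * r (Suc n) - (r p + r q) * r n + r q * r p) * (real n + 1) * (real n + 2) * (x * y) =
        4 * (3 * x * y - (real n + 2))"
      unfolding r_def of_nat_Suc xy(5-) using xy(1-4) by (simp add: divide_simps) algebra
    then have "(r n * r (Suc n) - (r p + r q) * r n + r q * r p) * (real n + 1) * (real n + 2) =
        4 * (3 - (real n + 2) / (x * y))"
      using xy(1,2) by (simp add: field_simps)
    then have "(r n * r (Suc n) - (r p + r q) * r n + r q * r p) * (real n + 1) * (real n + 2) / (2 * r n) =
        4 / (2 * r n) * (3 - (real n + 2) / (x * y))"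
      by (simp only: times_divide_eq_left)
    moreover have "4 / (2 * r n) = (real n + 1) / (2 * real n + 1)"
      by (simp add: r_def divide_simps) (simp add: algebra_simps)
    ultimately show ?thesis by (simp only: x_def y_def)
  qed
  finally show ?thesis .
qed

section \<open>Wallis bounds for central binomial coefficients\<close>

text \<open>The Wallis product up to \<open>n\<close> is the inverse of twice the
  \<open>n\<close>-th term here, so its limit \<open>pi / 2\<close> is inverted and halved.\<close>

lemma wallis_scaled_central:
  "(\<lambda>n. (real n + 1 / 2) * (central n / 4 ^ n)\<^sup>2) \<longlonglongrightarrow> 1 / pi"
proof -
  have "(\<Prod>k=1..n. (4 * real k ^ 2) / (4 * real k ^ 2 - 1)) =
      inverse (2 * ((real n + 1 / 2) * (central n / 4 ^ n)\<^sup>2))" for n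
  proof (induction n)
    case 0
    then show ?case by (simp add: central_def even_walks_0)
  next
    case (Suc n)
    have "4 * (real n + 1) ^ 2 - 1 = (2 * real n + 1) * (2 * real n + 3)"
      by (simp add: power2_eq_square algebra_simps)
    then have "4 * real (Suc n) ^ 2 / (4 * real (Suc n) ^ 2 - 1) =
        4 * (real n + 1)\<^sup>2 / ((2 * real n + 1) * (2 * real n + 3))"
      by (simp add: add.commute)
    moreover have "(\<Prod>k=1..Suc n. (4 * real k ^ 2) / (4 * real k ^ 2 - 1)) =
        (\<Prod>k=1..n. (4 * real k ^ 2) / (4 * real k ^ 2 - 1)) *
        (4 * real (Suc n) ^ 2 / (4 * real (Suc n) ^ 2 - 1))"
      by (simp add: prod.nat_ivl_Suc' mult.commute)
    moreover have "inverse (2 * ((real (Suc n) + 1 / 2) * (central (Suc n) / 4 ^ Suc n)\<^sup>2)) =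
        inverse (2 * ((real n + 1 / 2) * (central n / 4 ^ n)\<^sup>2)) *
        (4 * (real n + 1)\<^sup>2 / ((2 * real n + 1) * (2 * real n + 3)))"
    proof -
      define c x where "c = central n / 4 ^ n" and "x = 2 * real n + 1"
      have "c > 0" "x > 0" using central_pos[of n] by (auto simp: c_def x_def)
      have "central (Suc n) / 4 ^ Suc n = c * (x / (x + 1))"
        by (simp add: c_def x_def central_Suc divide_simps) (simp add: algebra_simps)
      moreover have "real n = (x - 1) / 2" by (simp add: x_def)
      moreover have "inverse (2 * ((1 + (x - 1) / 2 + 1 / 2) * (c * (x / (x + 1)))\<^sup>2)) =
          inverse (2 * (((x - 1) / 2 + 1 / 2) * c\<^sup>2)) *
          (4 * ((x - 1) / 2 + 1)\<^sup>2 / ((2 * ((x - 1) / 2) + 1) * (2 * ((x - 1) / 2) + 3)))"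
        using \<open>c > 0\<close> \<open>x > 0\<close>
        by (simp add: power2_eq_square divide_simps) (simp add: algebra_simps)
      ultimately show ?thesis
        unfolding c_def[symmetric] of_nat_Suc by (simp only:)
    qed
    ultimately show ?case using Suc by simp
  qed
  with wallis have "(\<lambda>n. inverse (2 * ((real n + 1 / 2) * (central n / 4 ^ n)\<^sup>2))) \<longlonglongrightarrow> pi / 2"
    by (simp only:)
  from tendsto_inverse[OF this, unfolded inverse_inverse_eq inverse_divide]
  have "(\<lambda>n. 2 * ((real n + 1 / 2) * (central n / 4 ^ n)\<^sup>2)) \<longlonglongrightarrow> 2 / pi"
    using pi_half_neq_zero by blast
  from tendsto_mult[OF tendsto_const[of "1 / 2"] this] show ?thesis by simp
qed

text \<open>For the squared scaled coefficient \<open>s n\<close>, the sequence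
  \<open>(n + 1/2) * s n\<close> decreases and \<open>n * s n\<close> increases. Both tend to
  \<open>1 / pi\<close>, which therefore bounds each from one side.\<close>

lemma scaled_central_bounds:
  assumes "0 < n"
  shows "1 / (pi * (real n + 1 / 2)) \<le> (central n / 4 ^ n)\<^sup>2"
    and "(central n / 4 ^ n)\<^sup>2 \<le> 1 / (pi * real n)"
proof -
  define s where "s m = (central m / 4 ^ m)\<^sup>2" for m
  have s_Suc: "s (Suc m) = s m * ((2 * real m + 1) / (2 * real m + 2))\<^sup>2" for m
    by (simp add: s_def central_Suc power_mult_distrib power_divide[symmetric])
       (simp add: power2_eq_square divide_simps, simp add: algebra_simps)
  have s_nonneg: "0 \<le> s m" for m by (simp add: s_def)
  have "(real (Suc m) + 1 / 2) * s (Suc m) \<le> (real m + 1 / 2) * s m" for m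
  proof -
    \<comment> \<open>Equivalent to
      \<open>(2 * m + 1) * (2 * m + 3) \<le> (2 * m + 2)^2\<close>.\<close>
    have "(real (Suc m) + 1 / 2) * ((2 * real m + 1) / (2 * real m + 2))\<^sup>2 \<le> real m + 1 / 2"
      by (simp add: power2_eq_square divide_simps) (simp add: algebra_simps)
    from mult_right_mono[OF this s_nonneg[of m]] show ?thesis
      by (simp add: s_Suc mult_ac)
  qed
  then have "1 / pi \<le> (real n + 1 / 2) * s n"
    using wallis_scaled_central by (intro decseq_ge) (auto intro: decseq_SucI simp: s_def)
  then show "1 / (pi * (real n + 1 / 2)) \<le> (central n / 4 ^ n)\<^sup>2"
    using assms by (simp add: s_def[symmetric] divide_le_eq mult_ac)
  have "real m * s m \<le> real (Suc m) * s (Suc m)" for m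
  proof -
    \<comment> \<open>Equivalent to \<open>4 * m * (m + 1) \<le> (2 * m + 1)^2\<close>.\<close>
    have "real m \<le> real (Suc m) * ((2 * real m + 1) / (2 * real m + 2))\<^sup>2"
      by (simp add: power2_eq_square divide_simps) (simp add: algebra_simps)
    from mult_right_mono[OF this s_nonneg[of m]] show ?thesis
      by (simp add: s_Suc mult_ac)
  qed
  moreover have "(\<lambda>n. real n * s n) \<longlonglongrightarrow> 1 / pi"
  proof -
    have "(\<lambda>n. real n / (real n + 1 / 2)) \<longlonglongrightarrow> 1" by real_asymp
    from tendsto_mult[OF this wallis_scaled_central] show ?thesis
      by (simp add: s_def add_pos_pos[THEN less_imp_neq, symmetric] divide_simps)
  qed
  ultimately have "real n * s n \<le> 1 / pi"
    by (intro incseq_le) (auto intro: incseq_SucI)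
  then show "(central n / 4 ^ n)\<^sup>2 \<le> 1 / (pi * real n)"
    using assms by (simp add: s_def field_simps)
qed

section \<open>The quotient of three central binomial coefficients\<close>

definition central_ratio :: "nat \<Rightarrow> nat \<Rightarrow> real" where
  "central_ratio q p = central q * central p / central (q + p)"

lemma central_ratio_nonneg: "0 \<le> central_ratio q p"
  using central_pos by (simp add: central_ratio_def less_imp_le)

text \<open>The powers of 4 cancel. Lower bounds for the numerator combine with the upper bound for
  the denominator, and conversely; squaring keeps the bounds free of roots.\<close>

lemma central_ratio_bounds:
  assumes "0 < q" "0 < p"
  shows "(real q + real p) / (pi * ((real q + 1 / 2) * (real p + 1 / 2))) \<le> (central_ratio q p)\<^sup>2"
    and "(central_ratio q p)\<^sup>2 \<le> (real q + real p + 1 / 2) / (pi * (real q * real p))"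
proof -
  define s where "s m = (central m / 4 ^ m)\<^sup>2" for m
  have s_pos: "0 < s m" for m
    using central_pos[of m] by (simp add: s_def)
  have lower: "1 / (pi * (real m + 1 / 2)) \<le> s m" and upper: "s m \<le> 1 / (pi * real m)"
    if "0 < m" for m
    using scaled_central_bounds[OF that] by (simp_all add: s_def)
  have eq: "(central_ratio q p)\<^sup>2 = s q * s p / s (q + p)"
    by (simp add: central_ratio_def s_def power_divide power_mult_distrib power_add)
  have "(real q + real p) / (pi * ((real q + 1 / 2) * (real p + 1 / 2))) =
      1 / (pi * (real q + 1 / 2)) * (1 / (pi * (real p + 1 / 2))) / (1 / (pi * real (q + p)))"
    by simp
  also have "\<dots> \<le> s q * s p / s (q + p)"
    using assms by (intro frac_le mult_mono lower upper mult_nonneg_nonneg) (auto simp: s_pos less_imp_le)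
  finally show "(real q + real p) / (pi * ((real q + 1 / 2) * (real p + 1 / 2))) \<le> (central_ratio q p)\<^sup>2"
    by (simp add: eq)
  have "s q * s p / s (q + p) \<le>
      1 / (pi * real q) * (1 / (pi * real p)) / (1 / (pi * (real (q + p) + 1 / 2)))"
    using assms by (intro frac_le mult_mono lower upper mult_nonneg_nonneg)
      (auto simp: s_pos less_imp_le intro!: mult_pos_pos)
  also have "\<dots> = (real q + real p + 1 / 2) / (pi * (real q * real p))"
    by simp
  finally show "(central_ratio q p)\<^sup>2 \<le> (real q + real p + 1 / 2) / (pi * (real q * real p))"
    by (simp add: eq)
qed

section \<open>Order estimates\<close>

lemma shifted_square_ratio_bigo:
  "(\<lambda>n. real n * real n / ((real n + c) * (real n + d)) - 1) \<in> O(\<lambda>n. 1 / real n)"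
  by real_asymp

lemma shifted_ratio_bigo:
  "(\<lambda>n. (real n + c) / (real n + d) - 1) \<in> O(\<lambda>n. 1 / real n)"
  by real_asymp

text \<open>In \<open>x - 1 = (sqrt x - 1) * (sqrt x + 1)\<close> the second factor is at least 1.
  This passes an order bound for \<open>x - 1\<close> on to \<open>sqrt x - 1\<close>.\<close>

lemma abs_sqrt_minus_1_le:
  assumes "0 \<le> x"
  shows "\<bar>sqrt x - 1\<bar> \<le> \<bar>x - 1\<bar>"
proof -
  have "x - 1 = (sqrt x - 1) * (sqrt x + 1)"
    using assms by (simp add: algebra_simps)
  then have "\<bar>x - 1\<bar> = \<bar>sqrt x - 1\<bar> * (sqrt x + 1)"
    using assms by (simp add: abs_mult)
  moreover have "\<bar>sqrt x - 1\<bar> * 1 \<le> \<bar>sqrt x - 1\<bar> * (sqrt x + 1)"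
    using assms by (intro mult_left_mono) auto
  ultimately show ?thesis by simp
qed

lemma bigo_sandwich:
  fixes f l u g :: "nat \<Rightarrow> real"
  assumes "(\<lambda>n. l n - c) \<in> O(g)" "(\<lambda>n. u n - c) \<in> O(g)"
    and "\<forall>\<^sub>F n in sequentially. l n \<le> f n \<and> f n \<le> u n"
  shows "(\<lambda>n. f n - c) \<in> O(g)"
proof -
  have "(\<lambda>n. \<bar>l n - c\<bar> + \<bar>u n - c\<bar>) \<in> O(g)"
    using assms(1,2) by (intro sum_in_bigo) simp_all
  moreover have "(\<lambda>n. f n - c) \<in> O(\<lambda>n. \<bar>l n - c\<bar> + \<bar>u n - c\<bar>)"
    by (intro bigoI[of _ 1] eventually_mono[OF assms(3)]) auto
  ultimately show ?thesis by (rule landau_o.big_trans[rotated])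
qed

section \<open>Asymptotics of the pressure\<close>

theorem mainTheorem6:
  fixes a :: real
  assumes "0 < a" and "a < 1"
  defines "q \<equiv> \<lambda>n::nat. 2 * nat \<lfloor>a * real n / 2\<rfloor>"
  shows "\<exists>E :: nat \<Rightarrow> real. E \<in> O(\<lambda>n. real n powr (- (3 / 2))) \<and>
    (\<forall>\<^sub>F n in sequentially.
       0 < q n \<and> q n < n \<and> C_pf n 2 0 \<noteq> 0 \<and> 0 < 1 - Z_star n 2 (q n) / C_pf n 2 0 \<and>
       P_S n 2 (q n) = ln (1 - 3 / (2 * sqrt (pi * real n * a * (1 - a))) + E n))"
proof -
  define p where "p n = n - q n" for n
  define R where "R n = Z_star n 2 (q n) / C_pf n 2 0" for n
  \<comment> \<open>For large \<open>n\<close>, \<open>R n = sqrt (X n) * T n / sqrt (D n)\<close>.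
    Here \<open>1 / D n\<close> is the leading order of the squared central ratio, so
    \<open>X n\<close> tends to 1, while \<open>T n\<close> tends to 3/2.\<close>
  define D where "D n = pi * real n * a * (1 - a)" for n
  define X where "X n = D n * (central_ratio (q n) (p n))\<^sup>2" for n
  define T where "T n = (real n + 1) / (2 * real n + 1) *
    (3 - (real n + 2) / ((real (q n) + 1) * (real (p n) + 1)))" for n
  \<comment> \<open>Taking the exact error makes the formula for the logarithm an identity; what
    remains is the size of \<open>E\<close> and the side conditions.\<close>
  define E where "E n = 3 / (2 * sqrt (D n)) - R n" for n
  \<comment> \<open>Rounding down loses less than 1, and the doubling turns this into 2.\<close>
  have q: "a * real n - 2 < real (q n)" "real (q n) \<le> a * real n" for n
  proof -
    have "real (q n) = 2 * of_int \<lfloor>a * real n / 2\<rfloor>"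
      using assms by (simp add: q_def)
    then show "a * real n - 2 < real (q n)" "real (q n) \<le> a * real n"
      by linarith+
  qed
  have large: "\<forall>\<^sub>F n in sequentially. 2 < a * real n"
    using \<open>0 < a\<close> by real_asymp
  have pq: "0 < q n" "q n < n" "n = q n + p n" "0 < p n" "0 < real n"
      "(1 - a) * real n \<le> real (p n)" "real (p n) < (1 - a) * real n + 2"
    if "2 < a * real n" for n
  proof -
    show n: "0 < real n" using that by (cases n) auto
    then have "a * real n < real n" using \<open>a < 1\<close> by simp
    then show "0 < q n" "q n < n" using q[of n] that by linarith+
    then show "n = q n + p n" "0 < p n" by (simp_all add: p_def)
    then have "real (p n) = real n - real (q n)" by linarith
    then show "(1 - a) * real n \<le> real (p n)" "real (p n) < (1 - a) * real n + 2"
      using q[of n] by (simp_all add: algebra_simps)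
  qed
  have D_pos: "0 < D n" if "2 < a * real n" for n
    using pq(5)[OF that] assms(1,2) by (simp add: D_def)
  have X_nonneg: "0 \<le> X n" for n
    using assms(1,2) by (simp add: X_def D_def)

  have X_bigo: "(\<lambda>n. X n - 1) \<in> O(\<lambda>n. 1 / real n)"
  proof (rule bigo_sandwich[OF shifted_square_ratio_bigo shifted_ratio_bigo])
    \<comment> \<open>The shifts come from \<open>q + 1/2 \<le> a * n + 1/2\<close>,
      \<open>p + 1/2 < (1 - a) * n + 5/2\<close> and \<open>q > a * n - 2\<close>, each constant
      being divided by the slope \<open>a\<close> or \<open>1 - a\<close>.\<close>
    show "\<forall>\<^sub>F n in sequentially.
        real n * real n / ((real n + 1 / (2 * a)) * (real n + 5 / (2 * (1 - a)))) \<le> X n \<and>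
        X n \<le> (real n + 1 / 2) / (real n + - (2 / a))"
      using large
    proof (rule eventually_mono)
      fix n assume n: "2 < a * real n"
      let ?q = "real (q n)" and ?p = "real (p n)"
      note pq = pq[OF n] and q = q[of n]
      have nqp: "real n = ?q + ?p" using pq(3) by linarith
      have X_eq: "X n = real n * a * (1 - a) * (pi * (central_ratio (q n) (p n))\<^sup>2)"
        by (simp add: X_def D_def)
      have "real n / ((a * real n + 1 / 2) * ((1 - a) * real n + 5 / 2)) \<le>
          real n / ((?q + 1 / 2) * (?p + 1 / 2))"
        using pq q by (intro divide_left_mono mult_mono mult_pos_pos) auto
      also have "\<dots> = pi * ((?q + ?p) / (pi * ((?q + 1 / 2) * (?p + 1 / 2))))"
        by (simp add: nqp)
      also have "\<dots> \<le> pi * (central_ratio (q n) (p n))\<^sup>2"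
        by (intro mult_left_mono central_ratio_bounds pq) simp
      finally have lower: "real n / ((a * real n + 1 / 2) * ((1 - a) * real n + 5 / 2)) \<le>
        pi * (central_ratio (q n) (p n))\<^sup>2" .
      have "pi * (central_ratio (q n) (p n))\<^sup>2 \<le> pi * ((?q + ?p + 1 / 2) / (pi * (?q * ?p)))"
        by (intro mult_left_mono central_ratio_bounds pq) simp
      also have "\<dots> = (real n + 1 / 2) / (?q * ?p)"
        by (simp add: nqp)
      also have "\<dots> \<le> (real n + 1 / 2) / ((a * real n - 2) * ((1 - a) * real n))"
        using n pq q assms(1,2) by (intro divide_left_mono mult_mono mult_pos_pos) auto
      finally have upper: "pi * (central_ratio (q n) (p n))\<^sup>2 \<le>
        (real n + 1 / 2) / ((a * real n - 2) * ((1 - a) * real n))" .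
      have "0 \<le> real n * a * (1 - a)" using assms(1,2) by simp
      with lower upper have
        "real n * a * (1 - a) * (real n / ((a * real n + 1 / 2) * ((1 - a) * real n + 5 / 2))) \<le> X n \<and>
         X n \<le> real n * a * (1 - a) * ((real n + 1 / 2) / ((a * real n - 2) * ((1 - a) * real n)))"
        unfolding X_eq by (intro conjI mult_left_mono)
      moreover have "real n * a * (1 - a) * (real n / ((a * real n + 1 / 2) * ((1 - a) * real n + 5 / 2))) =
        real n * real n / ((real n + 1 / (2 * a)) * (real n + 5 / (2 * (1 - a))))"
        using assms(1,2) by (simp add: divide_simps) (simp add: algebra_simps)
      moreover have "real n * a * (1 - a) * ((real n + 1 / 2) / ((a * real n - 2) * ((1 - a) * real n))) =
        (real n + 1 / 2) / (real n + - (2 / a))"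
        using n pq(5) assms(1,2) by (simp add: divide_simps)
      ultimately show "real n * real n / ((real n + 1 / (2 * a)) * (real n + 5 / (2 * (1 - a)))) \<le> X n \<and>
         X n \<le> (real n + 1 / 2) / (real n + - (2 / a))"
        by simp
    qed
  qed

  have T_bigo: "(\<lambda>n. T n - 3 / 2) \<in> O(\<lambda>n. 1 / real n)"
  proof (rule bigo_sandwich)
    \<comment> \<open>Lower bound for \<open>T n\<close> from \<open>q + 1 > a * n - 1\<close> and
      \<open>p + 1 \<ge> (1 - a) * n + 1\<close>; the upper bound drops the subtracted term, which
      is of order \<open>1 / n\<close>.\<close>
    show "(\<lambda>n. (real n + 1) / (2 * real n + 1) *
        (3 - (real n + 2) / ((a * real n - 1) * ((1 - a) * real n + 1))) - 3 / 2) \<in> O(\<lambda>n. 1 / real n)"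
      using assms(1,2) by real_asymp
    show "(\<lambda>n. (real n + 1) / (2 * real n + 1) * 3 - 3 / 2) \<in> O(\<lambda>n. 1 / real n)"
      by real_asymp
    show "\<forall>\<^sub>F n in sequentially. (real n + 1) / (2 * real n + 1) *
          (3 - (real n + 2) / ((a * real n - 1) * ((1 - a) * real n + 1))) \<le> T n \<and>
        T n \<le> (real n + 1) / (2 * real n + 1) * 3"
      using large
    proof (rule eventually_mono)
      fix n assume n: "2 < a * real n"
      note pq = pq[OF n] and q = q[of n]
      have "(real n + 2) / ((real (q n) + 1) * (real (p n) + 1)) \<le>
          (real n + 2) / ((a * real n - 1) * ((1 - a) * real n + 1))"
        using n pq q assms(1,2)
        by (intro divide_left_mono mult_mono mult_pos_pos add_nonneg_pos) auto
      then show "(real n + 1) / (2 * real n + 1) *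
          (3 - (real n + 2) / ((a * real n - 1) * ((1 - a) * real n + 1))) \<le> T n \<and>
        T n \<le> (real n + 1) / (2 * real n + 1) * 3"
        unfolding T_def by (intro conjI mult_left_mono) auto
    qed
  qed

  have R_eq: "R n = 1 / sqrt (D n) * (sqrt (X n) * T n)" if "2 < a * real n" for n
  proof -
    have "sqrt (X n) = sqrt (D n) * central_ratio (q n) (p n)"
      using central_ratio_nonneg by (simp add: X_def real_sqrt_mult)
    moreover have "R n = central_ratio (q n) (p n) * T n"
      unfolding R_def Z_star_ratio[OF pq(3)[OF that]] T_def central_ratio_def
      using pq(3)[OF that] by simp
    ultimately show ?thesis using D_pos[OF that] by simp
  qed
  have "(\<lambda>n. sqrt (X n) - 1) \<in> O(\<lambda>n. X n - 1)"
    using abs_sqrt_minus_1_le[OF X_nonneg] by (intro bigoI[of _ 1]) simp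
  then have sqrt_bigo: "(\<lambda>n. sqrt (X n) - 1) \<in> O(\<lambda>n. 1 / real n)"
    using X_bigo landau_o.big_trans by blast
  have "(\<lambda>n. T n - 3 / 2) \<in> O(\<lambda>n. 1)"
    using T_bigo by (rule landau_o.big_trans) real_asymp
  then have "(\<lambda>n. (T n - 3 / 2) + 3 / 2) \<in> O(\<lambda>n. 1)"
    by (rule sum_in_bigo) simp
  \<comment> \<open>The sum equals \<open>sqrt (X n) * T n - 3 / 2\<close>. Division by
    \<open>sqrt (D n)\<close> then supplies the remaining half power of \<open>n\<close>.\<close>
  then have "(\<lambda>n. (sqrt (X n) - 1) * T n + (T n - 3 / 2)) \<in> O(\<lambda>n. 1 / real n)"
    using landau_o.big.mult[OF sqrt_bigo, of T "\<lambda>_. 1"] T_bigo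
    by (intro sum_in_bigo(1)) simp_all
  moreover have "(\<lambda>n. - 1 / sqrt (D n)) \<in> O(\<lambda>n. real n powr (- (1 / 2)))"
    unfolding D_def using assms(1,2) by real_asymp
  ultimately have "(\<lambda>n. - 1 / sqrt (D n) * ((sqrt (X n) - 1) * T n + (T n - 3 / 2)))
      \<in> O(\<lambda>n. real n powr (- (1 / 2)) * (1 / real n))"
    by (intro landau_o.big.mult)
  moreover have "(\<lambda>n. real n powr (- (1 / 2)) * (1 / real n)) \<in> O(\<lambda>n. real n powr (- (3 / 2)))"
    by real_asymp
  ultimately have "(\<lambda>n. - 1 / sqrt (D n) * ((sqrt (X n) - 1) * T n + (T n - 3 / 2)))
      \<in> O(\<lambda>n. real n powr (- (3 / 2)))"
    by (rule landau_o.big_trans)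
  moreover have "\<forall>\<^sub>F n in sequentially.
      - 1 / sqrt (D n) * ((sqrt (X n) - 1) * T n + (T n - 3 / 2)) = E n"
    using large
  proof (rule eventually_mono)
    fix n assume n: "2 < a * real n"
    show "- 1 / sqrt (D n) * ((sqrt (X n) - 1) * T n + (T n - 3 / 2)) = E n"
      unfolding E_def R_eq[OF n] using D_pos[OF n] by (simp add: field_simps)
  qed
  ultimately have E_bigo: "E \<in> O(\<lambda>n. real n powr (- (3 / 2)))"
    by (rule landau_o.big.in_cong[THEN iffD1, rotated])
  \<comment> \<open>Error and main term both tend to 0, hence so does \<open>R n\<close>, and the
    argument of \<open>ln\<close> is eventually positive.\<close>
  have "(\<lambda>n. real n powr (- (3 / 2))) \<in> o(\<lambda>n. 1)" by real_asymp
  with E_bigo have "E \<in> o(\<lambda>n. 1)" by (rule landau_o.big_small_trans)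
  then have "E \<longlonglongrightarrow> 0" using smalloD_tendsto by fastforce
  moreover have "(\<lambda>n. 3 / (2 * sqrt (D n))) \<longlonglongrightarrow> 0"
    unfolding D_def using assms(1,2) by real_asymp
  ultimately have "(\<lambda>n. 3 / (2 * sqrt (D n)) - E n) \<longlonglongrightarrow> 0 - 0"
    by (intro tendsto_diff)
  then have "R \<longlonglongrightarrow> 0" by (simp add: E_def)
  then have "\<forall>\<^sub>F n in sequentially. R n < 1"
    by (rule order_tendstoD) simp
  with large have "\<forall>\<^sub>F n in sequentially.
       0 < q n \<and> q n < n \<and> C_pf n 2 0 \<noteq> 0 \<and> 0 < 1 - Z_star n 2 (q n) / C_pf n 2 0 \<and>
       P_S n 2 (q n) = ln (1 - 3 / (2 * sqrt (pi * real n * a * (1 - a))) + E n)"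
  proof eventually_elim
    case (elim n)
    have "C_pf n 2 0 > 0"
      unfolding C_pf_2_0 using central_pos by (intro divide_pos_pos mult_pos_pos) auto
    with elim pq[of n] show ?case
      by (simp add: P_S_def E_def D_def R_def)
  qed
  with E_bigo show ?thesis by blast
qed

end
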